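(* Let $\times_\Sigma$ be a product on components (under an interaction signature $\Sigma$) that is commutative, associative and idempotent, and such that for any two components $C$ and $D$ with the same interface, $C \times_\Sigma D \leq C$, where $\leq$ is the containment relation on components. Let $A$ and $B$ be components such that $A$ is divisible by $B$ under $\times_\Sigma$. Then, for any set of events $E$, any finite subset of the set of quotients $A/^*_\Sigma B=\{C \mid B \times_\Sigma C = A\}$ all of whose elements have interface $E$ has a lower bound with respect to $\leq$ that is itself an element of $A/^*_\Sigma B$.
   Context: A timed-event stream (TES) over a set of events $E$ is an infinite sequence $\sigma$ with $\sigma(i)=(O_i,t_i)$, $i\in\mathbb{N}$, where $O_i\subseteq E$ and $t_i\in\mathbb{R}_+$, such that $t_i<t_{i+1}$ for all $i$ and for every $t\in\mathbb{R}_+$ there is $i$ with $t<t_i$ (non-Zeno). Write $\mathrm{pr}_1(\sigma)(i)=O_i$ and $\mathrm{pr}_2(\sigma)(i)=t_i$; $\mathrm{TES}(E)$ is the set of all TESs over $E$. A component is a pair $C=(E,L)$ with $E$ a set of events (its interface) and $L\subseteq \mathrm{TES}(E)$ (its behavior); components are equal iff interfaces and behaviors are equal. An interaction signature is $\Sigma=(R,\oplus)$, where for sets of events $E_A,E_B$, $R(E_A,E_B)\subseteq \mathrm{TES}(E_A)\times\mathrm{TES}(E_B)$ is a composability relation and $\oplus:\mathrm{TES}(E_A)\times\mathrm{TES}(E_B)\to\mathrm{TES}(E_A\cup E_B)$ a composition function. The product of $A=(E_A,L_A)$ and $B=(E_B,L_B)$ under $\Sigma$ is $A\times_\Sigma B=(E_A\cup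 E_B,\{\sigma\oplus\tau\mid \sigma\in L_A,\tau\in L_B,(\sigma,\tau)\in R(E_A,E_B)\})$. The product is commutative if $A\times_\Sigma B=B\times_\Sigma A$, associative if $(A\times_\Sigma B)\times_\Sigma C=A\times_\Sigma(B\times_\Sigma C)$, and idempotent if $A\times_\Sigma A=A$, for all components. For TESs, $\sigma\leq\tau$ iff $\mathrm{pr}_1(\sigma)(i)\subseteq\mathrm{pr}_1(\tau)(i)$ for all $i$ and $\mathrm{pr}_2(\sigma)=\mathrm{pr}_2(\tau)$. For components, $(E_A,L_A)\leq(E_B,L_B)$ iff $E_A\subseteq E_B$ and for every $\sigma\in L_A$ there is $\tau\in L_B$ with $\sigma\leq\tau$. $A$ is divisible by $B$ under $\times_\Sigma$ if there is a component $C$ with $B\times_\Sigma C=A$ (equivalently, by commutativity, $C\times_\Sigma B=A$). *)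

theory Defs
  imports Complex_Main
begin

type_synonym 'e stream = "nat \<Rightarrow> 'e set \<times> real"

definition pr1 :: "'e stream \<Rightarrow> nat \<Rightarrow> 'e set" where
  "pr1 \<sigma> i = fst (\<sigma> i)"

definition pr2 :: "'e stream \<Rightarrow> nat \<Rightarrow> real" where
  "pr2 \<sigma> i = snd (\<sigma> i)"

text \<open>The time domain \<open>\<real>\<^sub>+\<close> is read as the set of nonnegative reals.\<close>

definition TES :: "'e set \<Rightarrow> 'e stream set" where
  "TES E = {\<sigma>. (\<forall>i. pr1 \<sigma> i \<subseteq> E) \<and> (\<forall>i. 0 \<le> pr2 \<sigma> i) \<and>
                (\<forall>i. pr2 \<sigma> i < pr2 \<sigma> (Suc i)) \<and> (\<forall>t\<ge>0. \<exists>i. t < pr2 \<sigma> i)}"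

record 'e component =
  interface :: "'e set"
  behavior :: "'e stream set"

definition is_component :: "'e component \<Rightarrow> bool" where
  "is_component C \<longleftrightarrow> behavior C \<subseteq> TES (interface C)"

text \<open>Both the composability relation and the composition function are families indexed by a
  pair of interfaces. A composition function given by one formula for all interfaces is the
  special case of a constant family.\<close>

record 'e signature =
  composable :: "'e set \<Rightarrow> 'e set \<Rightarrow> ('e stream \<times> 'e stream) set"
  compose :: "'e set \<Rightarrow> 'e set \<Rightarrow> 'e stream \<Rightarrow> 'e stream \<Rightarrow> 'e stream"

definition interaction_signature :: "'e signature \<Rightarrow> bool" where
  "interaction_signature S \<longleftrightarrow>
     (\<forall>E\<^sub>A E\<^sub>B. composable S E\<^sub>A E\<^sub>B \<subseteq> TES E\<^sub>A \<times> TES E\<^sub>B) \<and>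
     (\<forall>E\<^sub>A E\<^sub>B. \<forall>\<sigma>\<in>TES E\<^sub>A. \<forall>\<tau>\<in>TES E\<^sub>B. compose S E\<^sub>A E\<^sub>B \<sigma> \<tau> \<in> TES (E\<^sub>A \<union> E\<^sub>B))"

definition product :: "'e signature \<Rightarrow> 'e component \<Rightarrow> 'e component \<Rightarrow> 'e component" where
  "product S A B =
     \<lparr>interface = interface A \<union> interface B,
      behavior = {compose S (interface A) (interface B) \<sigma> \<tau> | \<sigma> \<tau>.
        \<sigma> \<in> behavior A \<and> \<tau> \<in> behavior B \<and>
        (\<sigma>, \<tau>) \<in> composable S (interface A) (interface B)}\<rparr>"

lemma is_component_product:
  assumes "interaction_signature S" and "is_component A" and "is_component B"
  shows "is_component (product S A B)"
  using assms unfolding interaction_signature_def is_component_def product_def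
  by (simp, blast)

definition commutative_product :: "'e signature \<Rightarrow> bool" where
  "commutative_product S \<longleftrightarrow>
     (\<forall>A B. is_component A \<longrightarrow> is_component B \<longrightarrow> product S A B = product S B A)"

definition associative_product :: "'e signature \<Rightarrow> bool" where
  "associative_product S \<longleftrightarrow>
     (\<forall>A B C. is_component A \<longrightarrow> is_component B \<longrightarrow> is_component C \<longrightarrow>
        product S (product S A B) C = product S A (product S B C))"

definition idempotent_product :: "'e signature \<Rightarrow> bool" where
  "idempotent_product S \<longleftrightarrow> (\<forall>A. is_component A \<longrightarrow> product S A A = A)"

definition stream_le :: "'e stream \<Rightarrow> 'e stream \<Rightarrow> bool" where
  "stream_le \<sigma> \<tau> \<longleftrightarrow> (\<forall>i. pr1 \<sigma> i \<subseteq> pr1 \<tau> i) \<and> pr2 \<sigma> = pr2 \<tau>"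

definition component_le :: "'e component \<Rightarrow> 'e component \<Rightarrow> bool" where
  "component_le A B \<longleftrightarrow>
     interface A \<subseteq> interface B \<and> (\<forall>\<sigma>\<in>behavior A. \<exists>\<tau>\<in>behavior B. stream_le \<sigma> \<tau>)"

definition divisible :: "'e signature \<Rightarrow> 'e component \<Rightarrow> 'e component \<Rightarrow> bool" where
  "divisible S A B \<longleftrightarrow> (\<exists>C. is_component C \<and> product S B C = A)"

definition quotients :: "'e signature \<Rightarrow> 'e component \<Rightarrow> 'e component \<Rightarrow> 'e component set" where
  "quotients S A B = {C. is_component C \<and> product S B C = A}"

end

theory Submission
  imports Defs
begin

text \<open>
  The lower bound of a nonempty finite set of quotients is the product of its elements. That
  product is again a quotient: if \<open>B \<times> C = A = B \<times> D\<close>, then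
  \<open>B \<times> (C \<times> D) = (B \<times> C) \<times> D = (B \<times> D) \<times> D = B \<times> (D \<times> D) = B \<times> D = A\<close>.
\<close>

lemma component_le_refl: "component_le C C"
  unfolding component_le_def stream_le_def by blast

lemma component_le_trans:
  assumes "component_le C D" and "component_le D F"
  shows "component_le C F"
proof -
  have "\<exists>\<upsilon>\<in>behavior F. stream_le \<sigma> \<upsilon>" if "\<sigma> \<in> behavior C" for \<sigma>
  proof -
    obtain \<tau> where \<tau>: "\<tau> \<in> behavior D" "stream_le \<sigma> \<tau>"
      using assms(1) \<open>\<sigma> \<in> behavior C\<close> by (auto simp: component_le_def)
    obtain \<upsilon> where \<upsilon>: "\<upsilon> \<in> behavior F" "stream_le \<tau> \<upsilon>"
      using assms(2) \<tau>(1) by (auto simp: component_le_def)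
    have "stream_le \<sigma> \<upsilon>"
      using \<tau>(2) \<upsilon>(2) by (auto simp: stream_le_def)
    then show ?thesis
      using \<upsilon>(1) by blast
  qed
  moreover have "interface C \<subseteq> interface F"
    using assms by (auto simp: component_le_def)
  ultimately show ?thesis
    by (simp add: component_le_def)
qed

lemma interface_product: "interface (product S C D) = interface C \<union> interface D"
  by (simp add: product_def)

lemma product_in_quotients:
  assumes sig: "interaction_signature S"
    and assoc: "associative_product S"
    and idem: "idempotent_product S"
    and B: "is_component B"
    and C: "C \<in> quotients S A B"
    and D: "D \<in> quotients S A B"
  shows "product S C D \<in> quotients S A B"
proof -
  have comps: "is_component C" "is_component D"
    and eqs: "product S B C = A" "product S B D = A"
    using C D by (auto simp: quotients_def)
  have "product S B (product S C D) = product S (product S B C) D"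
    using assoc B comps by (simp add: associative_product_def)
  \<comment> \<open>Both \<open>product S B C\<close> and \<open>product S B D\<close> equal
    \<open>A\<close>, so one may replace the other. The exchange creates the second copy of
    \<open>D\<close> that idempotence then absorbs.\<close>
  also have "\<dots> = product S (product S B D) D"
    by (simp add: eqs)
  also have "\<dots> = product S B (product S D D)"
    using assoc B comps by (simp add: associative_product_def)
  also have "\<dots> = A"
    using idem comps eqs by (simp add: idempotent_product_def)
  finally show ?thesis
    using is_component_product[OF sig comps] by (simp add: quotients_def)
qed

theorem theorem1:
  fixes S :: "'e signature" and A B :: "'e component"
    and E :: "'e set" and Q :: "'e component set"
  assumes "interaction_signature S"
    and "commutative_product S"
    and "associative_product S"
    and "idempotent_product S"
    and "\<And>C D. is_component C \<Longrightarrow> is_component D \<Longrightarrow> interface C = interface D \<Longrightarrow>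
           component_le (product S C D) C"
    and "is_component A"
    and "is_component B"
    and "divisible S A B"
    and "finite Q"
    and "Q \<subseteq> quotients S A B"
    and "\<And>C. C \<in> Q \<Longrightarrow> interface C = E"
  shows "\<exists>D \<in> quotients S A B. \<forall>C \<in> Q. component_le D C"
proof (cases "Q = {}")
  case True
  \<comment> \<open>Every component bounds the empty set vacuously, so any quotient will do;
    divisibility supplies one.\<close>
  then show ?thesis
    using assms(8) by (auto simp: divisible_def quotients_def)
next
  case False
  \<comment> \<open>The bound is also required to have interface \<open>E\<close>: the induction
    step multiplies it by a new quotient, and containment in a factor is assumed only for equal
    interfaces. The induction starts at singletons, since for empty \<open>Q\<close> no quotient
    with interface \<open>E\<close> need exist.\<close>
  have "\<exists>D \<in> quotients S A B. interface D = E \<and> (\<forall>C \<in> Q. component_le D C)"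
    using assms(9) False assms(10,11)
  proof (induction Q rule: finite_ne_induct)
    case (singleton C)
    then show ?case
      using component_le_refl by auto
  next
    case (insert C Q)
    have "Q \<subseteq> quotients S A B"
      using insert.prems(1) by simp
    then obtain D where D: "D \<in> quotients S A B" "interface D = E"
      and lower: "\<And>F. F \<in> Q \<Longrightarrow> component_le D F"
      using insert.IH insert.prems(2) by (meson insertI2)
    have C: "C \<in> quotients S A B" "interface C = E"
      using insert.prems(1) insert.prems(2)[of C] by simp_all
    have comps: "is_component C" "is_component D"
      using C D by (auto simp: quotients_def)
    have quot: "product S C D \<in> quotients S A B"
      using product_in_quotients assms(1,3,4,7) C(1) D(1) by blast
    have le_C: "component_le (product S C D) C"
      using assms(5) comps C D by simp
    \<comment> \<open>The containment hypothesis bounds a product by its left factor only; swapping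
      the factors gives the bound by \<open>D\<close>.\<close>
    have "product S C D = product S D C"
      using assms(2) comps by (simp add: commutative_product_def)
    then have le_D: "component_le (product S C D) D"
      using assms(5) comps C D by simp
    \<comment> \<open>The product lies below \<open>C\<close> directly and below each element of
      \<open>Q\<close> by way of \<open>D\<close>.\<close>
    have "\<forall>F \<in> insert C Q. component_le (product S C D) F"
      using le_C component_le_trans[OF le_D lower] by auto
    moreover have "interface (product S C D) = E"
      using C D by (simp add: interface_product)
    ultimately show ?case
      using quot by blast
  qed
  then show ?thesis
    by blast
qed

end
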